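(* Let $q$ be a rational prime and view $g_r^-(x)\in\mathbb Z[x]\subset\mathbb Q_q[x]$. Then the splitting field of $g_r^-$ over $\mathbb Q_q$ is $\mathbb Q_q(\omega)\big(\gamma_0,\ \delta_{\mathbb Q}\,\tau\,\sqrt{s_0(s_0-1)}\big)$.
   Context: Let $r\ge5$ be prime, $\zeta_r$ a primitive $r$-th root of unity, $\omega_j=\zeta_r^j+\zeta_r^{-j}$, $\omega=\omega_1$, $\tau=\zeta_r-\zeta_r^{-1}$; $h_r(x)=\prod_{j=1}^{(r-1)/2}(x-\omega_j)\in\mathbb Z[x]$, $g_{r,s}^-(x)=(-1)^{(r-1)/2}x\,h_r(2-x^2)+2-4s$. Fix $s_0\in\overline{\mathbb Q}\setminus\{0,1\}$ and $\delta_{\mathbb Q}\in\overline{\mathbb Z}\setminus\{0\}$ with $\delta_{\mathbb Q}^2\in\mathbb Z$ and $\delta_{\mathbb Q}^r(2-4s_0)\in\mathbb Z$; $g_r^-(x)=\delta_{\mathbb Q}^rg^-_{r,s_0}(x/\delta_{\mathbb Q})$. Fix an embedding $\overline{\mathbb Q}\hookrightarrow\overline{\mathbb Q}_q$ and regard all these elements in $\overline{\mathbb Q}_q$. Choose square roots $\sqrt{s_0},\sqrt{s_0-1}$, put $\sqrt{s_0(s_0-1)}=\sqrt{s_0}\sqrt{s_0-1}$, let $\alpha_0\in\overline{\mathbb Q}_q$ be an $r$-th root of $2s_0-1+2\sqrt{s_0(s_0-1)}$, and $\gamma_0=\delta_{\mathbb Q}(\alpha_0+\alpha_0^{-1})$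 (a root of $g_r^-$). *)

theory Defs
  imports
    "HOL-Algebra.Algebraic_Closure_Type"
    "HOL-Algebra.Generated_Fields"
    "HOL-Computational_Algebra.Fraction_Field"
    "Berlekamp_Zassenhaus.Finite_Field"
begin

text \<open>
  The \<open>p\<close>-adic integers, for the prime \<open>p = CARD('p)\<close>, as the inverse limit of the rings
  \<open>\<int>/p\<^sup>n\<int>\<close>: the \<open>n\<close>-th component of a sequence is the representative in \<open>{0..<p\<^sup>n}\<close> of
  its residue class modulo \<open>p\<^sup>n\<close>.
\<close>

typedef (overloaded) ('p :: prime_card) padic_int =
  "{x :: nat \<Rightarrow> int. \<forall>n. x n = x (Suc n) mod int CARD('p) ^ n}"
  by (rule exI[of _ "\<lambda>_. 0"]) auto

setup_lifting type_definition_padic_int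

lemma padic_coherent:
  fixes a b c d M N :: int
  assumes "N dvd M"
  shows "a mod N = a mod M mod N"
    and "\<lbrakk>a = c mod N; b = d mod N\<rbrakk> \<Longrightarrow> (a + b) mod N = (c + d) mod M mod N"
    and "\<lbrakk>a = c mod N; b = d mod N\<rbrakk> \<Longrightarrow> (a - b) mod N = (c - d) mod M mod N"
    and "\<lbrakk>a = c mod N; b = d mod N\<rbrakk> \<Longrightarrow> (a * b) mod N = (c * d) mod M mod N"
    and "a = c mod N \<Longrightarrow> (- a) mod N = (- c) mod M mod N"
  using assms by (simp_all add: mod_mod_cancel mod_simps)

lemma pow_dvd_pow_Suc: "(p :: int) ^ n dvd p ^ Suc n"
  by simp

lemma Rep_padic_int_Suc:
  "Rep_padic_int x (Suc n) mod int CARD('p) ^ n = Rep_padic_int (x :: 'p :: prime_card padic_int) n"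
proof -
  have *: "\<forall>n. Rep_padic_int x n = Rep_padic_int x (Suc n) mod int CARD('p) ^ n"
    using Rep_padic_int[of x] by (rule CollectD)
  show ?thesis
    by (rule sym, rule spec[OF *, of n])
qed

lemma Rep_padic_int_mod [simp]:
  "Rep_padic_int x n mod int CARD('p) ^ n = Rep_padic_int (x :: 'p :: prime_card padic_int) n"
  by (metis Rep_padic_int_Suc mod_mod_trivial)

lemma padic_int_eq_iff: "x = y \<longleftrightarrow> (\<forall>n. Rep_padic_int x n = Rep_padic_int y n)"
  by (simp add: fun_eq_iff flip: Rep_padic_int_inject)

instantiation padic_int :: (prime_card) comm_ring_1
begin

lift_definition zero_padic_int :: "'a padic_int" is "\<lambda>n. 0 mod int CARD('a) ^ n"
  by simp

lift_definition one_padic_int :: "'a padic_int" is "\<lambda>n. 1 mod int CARD('a) ^ n"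
  by (intro allI padic_coherent(1) pow_dvd_pow_Suc)

lift_definition plus_padic_int :: "'a padic_int \<Rightarrow> 'a padic_int \<Rightarrow> 'a padic_int"
  is "\<lambda>x y n. (x n + y n) mod int CARD('a) ^ n"
  by (blast intro: padic_coherent(2) pow_dvd_pow_Suc)

lift_definition uminus_padic_int :: "'a padic_int \<Rightarrow> 'a padic_int"
  is "\<lambda>x n. (- x n) mod int CARD('a) ^ n"
  by (blast intro: padic_coherent(5) pow_dvd_pow_Suc)

lift_definition minus_padic_int :: "'a padic_int \<Rightarrow> 'a padic_int \<Rightarrow> 'a padic_int"
  is "\<lambda>x y n. (x n - y n) mod int CARD('a) ^ n"
  by (blast intro: padic_coherent(3) pow_dvd_pow_Suc)

lift_definition times_padic_int :: "'a padic_int \<Rightarrow> 'a padic_int \<Rightarrow> 'a padic_int"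
  is "\<lambda>x y n. (x n * y n) mod int CARD('a) ^ n"
  by (blast intro: padic_coherent(4) pow_dvd_pow_Suc)

instance
proof
  fix a b c :: "'a padic_int"
  note ops = padic_int_eq_iff zero_padic_int.rep_eq one_padic_int.rep_eq plus_padic_int.rep_eq
    uminus_padic_int.rep_eq minus_padic_int.rep_eq times_padic_int.rep_eq
  show "a + b + c = a + (b + c)" "a + b = b + a" "0 + a = a" "- a + a = 0" "a - b = a + - b"
    "a * b * c = a * (b * c)" "a * b = b * a" "1 * a = a" "(a + b) * c = a * c + b * c"
    by (simp_all add: ops mod_simps algebra_simps)
  have "(1::int) mod int CARD('a) ^ 1 \<noteq> 0"
    using prime_card[where 'a = 'a] by (simp add: prime_gt_1_nat)
  then show "(0 :: 'a padic_int) \<noteq> 1"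
    unfolding ops by (metis mod_0)
qed

end

lemma padic_int_mod_le:
  fixes x :: "'p :: prime_card padic_int"
  assumes "m \<le> n"
  shows "Rep_padic_int x n mod int CARD('p) ^ m = Rep_padic_int x m"
  using assms
proof (induction n rule: dec_induct)
  case base
  show ?case by simp
next
  case (step n)
  have "Rep_padic_int x (Suc n) mod int CARD('p) ^ m
      = Rep_padic_int x (Suc n) mod int CARD('p) ^ n mod int CARD('p) ^ m"
    using step.hyps by (simp add: mod_mod_cancel le_imp_power_dvd)
  also have "\<dots> = Rep_padic_int x n mod int CARD('p) ^ m"
    by (simp add: Rep_padic_int_Suc)
  finally show ?case using step.IH by simp
qed

lemma padic_int_eq_0_iff:
  "(x :: 'p :: prime_card padic_int) = 0 \<longleftrightarrow> (\<forall>n. Rep_padic_int x n = 0)"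
  by (simp add: padic_int_eq_iff zero_padic_int.rep_eq)

instance padic_int :: (prime_card) idom
proof
  fix x y :: "'a padic_int"
  let ?p = "int CARD('a)"
  assume "x \<noteq> 0" "y \<noteq> 0"
  then obtain m n where m: "Rep_padic_int x m \<noteq> 0" and n: "Rep_padic_int y n \<noteq> 0"
    by (auto simp: padic_int_eq_0_iff)
  define a b where "a = Rep_padic_int x (m + n)" and "b = Rep_padic_int y (m + n)"
  have p: "prime ?p"
    using prime_card[where 'a = 'a] by simp
  have a: "\<not> ?p ^ m dvd a" and b: "\<not> ?p ^ n dvd b"
    using padic_int_mod_le[of m "m + n" x] padic_int_mod_le[of n "m + n" y] m n
    by (auto simp: a_def b_def dvd_eq_mod_eq_0)
  then have ab: "a \<noteq> 0" "b \<noteq> 0" by auto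
  have "multiplicity ?p a < m" "multiplicity ?p b < n"
    using a b multiplicity_dvd'[of m ?p a] multiplicity_dvd'[of n ?p b] not_less by blast+
  then have "multiplicity ?p (a * b) < m + n"
    using ab p by (simp add: prime_elem_multiplicity_mult_distrib)
  then have "\<not> ?p ^ (m + n) dvd a * b"
    using ab p by (metis mult_eq_0_iff multiplicity_geI not_less not_prime_unit)
  then have "Rep_padic_int (x * y) (m + n) \<noteq> 0"
    by (simp add: times_padic_int.rep_eq a_def b_def dvd_eq_mod_eq_0)
  then show "x * y \<noteq> 0"
    by (auto simp: padic_int_eq_0_iff)
qed

text \<open>The field \<open>\<rat>\<^sub>p\<close> of \<open>p\<close>-adic numbers, \<open>p = CARD('p)\<close>.\<close>

type_synonym 'p padic = "'p padic_int fract"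

definition field_adjoin :: "'a :: field set \<Rightarrow> 'a set \<Rightarrow> 'a set" where
  "field_adjoin K S = generate_field ring_of_type_algebra (K \<union> S)"

definition splitting_field :: "'a :: field poly \<Rightarrow> 'a alg_closure set" where
  "splitting_field f = field_adjoin (range to_ac) {x. poly (map_poly to_ac f) x = 0}"

definition primitive_root_of_unity :: "nat \<Rightarrow> 'a :: field \<Rightarrow> bool" where
  "primitive_root_of_unity n z \<longleftrightarrow> n > 0 \<and> z ^ n = 1 \<and> (\<forall>k. 0 < k \<and> k < n \<longrightarrow> z ^ k \<noteq> 1)"

definition omega :: "'a :: field \<Rightarrow> nat \<Rightarrow> 'a" where
  "omega \<zeta> j = \<zeta> ^ j + inverse \<zeta> ^ j"

definition tau :: "'a :: field \<Rightarrow> 'a" where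
  "tau \<zeta> = \<zeta> - inverse \<zeta>"

definition h_poly :: "nat \<Rightarrow> 'a :: field \<Rightarrow> 'a poly" where
  "h_poly r \<zeta> = (\<Prod>j = 1..(r - 1) div 2. [:- omega \<zeta> j, 1:])"

definition g_minus_s :: "nat \<Rightarrow> 'a :: field \<Rightarrow> 'a \<Rightarrow> 'a poly" where
  "g_minus_s r \<zeta> s =
     (-1) ^ ((r - 1) div 2) * ([:0, 1:] * pcompose (h_poly r \<zeta>) [:2, 0, -1:]) + [:2 - 4 * s:]"

definition g_minus :: "nat \<Rightarrow> 'a :: field \<Rightarrow> 'a \<Rightarrow> 'a \<Rightarrow> 'a poly" where
  "g_minus r \<zeta> s\<^sub>0 \<delta> = smult (\<delta> ^ r) (pcompose (g_minus_s r \<zeta> s\<^sub>0) [:0, 1 / \<delta>:])"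

end

theory Submission
  imports Defs
begin

text \<open>
  Up to its constant term, \<open>g\<^sub>r\<^sup>-\<close> is the Dickson polynomial with parameter \<open>\<delta>\<^sup>2\<close>, which sends \<open>u + v\<close>
  to \<open>u\<^sup>r + v\<^sup>r\<close> whenever \<open>u v = \<delta>\<^sup>2\<close>. Hence it has integer coefficients, and its roots are
  \<open>\<Gamma>\<^sub>k = \<zeta>\<^sup>k u + \<zeta>\<^sup>-\<^sup>k v\<close> with \<open>u = \<delta> \<alpha>\<^sub>0\<close> and \<open>v = \<delta> \<alpha>\<^sub>0\<^sup>-\<^sup>1\<close>. The relation
  \<open>\<Gamma>\<^sub>k\<^sub>+\<^sub>1 + \<Gamma>\<^sub>k\<^sub>-\<^sub>1 = \<omega> \<Gamma>\<^sub>k\<close> expresses \<open>\<omega>\<close> through the roots, since two consecutive roots do not both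
  vanish, and shows that \<open>\<omega>\<close>, \<open>\<Gamma>\<^sub>0 = \<gamma>\<^sub>0\<close> and \<open>\<Gamma>\<^sub>1 - \<Gamma>\<^sub>-\<^sub>1 = \<tau> (u - v)\<close> generate all of them. Finally
  \<open>4 \<delta>\<^sup>r \<surd>(s\<^sub>0 (s\<^sub>0 - 1)) = u\<^sup>r - v\<^sup>r\<close> is \<open>u - v\<close> times a Lucas polynomial in \<open>u + v = \<gamma>\<^sub>0\<close> and
  \<open>u v = \<delta>\<^sup>2\<close>. It is nonzero because \<open>s\<^sub>0\<close> is neither \<open>0\<close> nor \<open>1\<close>, so \<open>\<tau> (u - v)\<close> can be exchanged for
  \<open>\<delta> \<tau> \<surd>(s\<^sub>0 (s\<^sub>0 - 1))\<close>.
\<close>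

section \<open>Closure properties of generated fields\<close>

lemma field_adjoin_incl: "x \<in> K \<union> S \<Longrightarrow> x \<in> field_adjoin K S"
  unfolding field_adjoin_def by (rule generate_field.incl)

lemma field_adjoin_1: "1 \<in> field_adjoin K S"
  using generate_field.one[of ring_of_type_algebra "K \<union> S"]
  by (simp add: field_adjoin_def ring_of_type_algebra_def)

lemma field_adjoin_add:
  "x \<in> field_adjoin K S \<Longrightarrow> y \<in> field_adjoin K S \<Longrightarrow> x + y \<in> field_adjoin K S"
  using generate_field.eng_add[of x ring_of_type_algebra "K \<union> S" y]
  by (simp add: field_adjoin_def ring_of_type_algebra_def)

lemma field_adjoin_mult:
  "x \<in> field_adjoin K S \<Longrightarrow> y \<in> field_adjoin K S \<Longrightarrow> x * y \<in> field_adjoin K S"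
  using generate_field.eng_mult[of x ring_of_type_algebra "K \<union> S" y]
  by (simp add: field_adjoin_def ring_of_type_algebra_def)

lemma a_inv_ring_of_type_algebra:
  "a_inv ring_of_type_algebra x = - (x :: 'a :: field)"
proof -
  interpret R: field "ring_of_type_algebra :: 'a ring" ..
  show ?thesis
    by (rule R.minus_equality) (auto simp: ring_of_type_algebra_def)
qed

lemma m_inv_ring_of_type_algebra:
  assumes "x \<noteq> 0"
  shows "m_inv ring_of_type_algebra x = inverse (x :: 'a :: field)"
proof -
  interpret R: field "ring_of_type_algebra :: 'a ring" ..
  show ?thesis
    by (rule R.comm_inv_char) (use assms in \<open>auto simp: ring_of_type_algebra_def\<close>)
qed

lemma field_adjoin_uminus: "x \<in> field_adjoin K S \<Longrightarrow> - x \<in> field_adjoin K S"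
  using generate_field.a_inv[of x ring_of_type_algebra "K \<union> S"]
  by (simp add: field_adjoin_def a_inv_ring_of_type_algebra)

lemma field_adjoin_diff:
  "x \<in> field_adjoin K S \<Longrightarrow> y \<in> field_adjoin K S \<Longrightarrow> x - y \<in> field_adjoin K S"
  using field_adjoin_add[OF _ field_adjoin_uminus] by fastforce

lemma field_adjoin_0: "0 \<in> field_adjoin K S"
  using field_adjoin_diff[OF field_adjoin_1 field_adjoin_1] by simp

lemma field_adjoin_inverse: "x \<in> field_adjoin K S \<Longrightarrow> inverse x \<in> field_adjoin K S"
  using generate_field.m_inv[of x ring_of_type_algebra "K \<union> S"]
  \<comment> \<open>The generation rule inverts nonzero elements only; for \<open>x = 0\<close> the
    convention \<open>inverse 0 = 0\<close> settles the claim.\<close>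
  by (cases "x = 0")
    (auto simp: field_adjoin_def m_inv_ring_of_type_algebra, simp add: ring_of_type_algebra_def)

lemma field_adjoin_divide:
  "x \<in> field_adjoin K S \<Longrightarrow> y \<in> field_adjoin K S \<Longrightarrow> x / y \<in> field_adjoin K S"
  unfolding field_class.field_divide_inverse by (intro field_adjoin_mult field_adjoin_inverse)

lemma field_adjoin_2: "2 \<in> field_adjoin K S"
  using field_adjoin_add[OF field_adjoin_1 field_adjoin_1] by simp

lemmas field_adjoin_closed =
  field_adjoin_0 field_adjoin_1 field_adjoin_2 field_adjoin_add field_adjoin_mult field_adjoin_diff
  field_adjoin_divide

text \<open>The right-hand side is closed under the field operations, so an inclusion of generated
  fields need only be checked on generators.\<close>

lemma field_adjoin_least:
  assumes "K \<union> S \<subseteq> field_adjoin K' S'"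
  shows "field_adjoin K S \<subseteq> field_adjoin K' S'"
proof
  fix x assume "x \<in> field_adjoin K S"
  then have "x \<in> generate_field ring_of_type_algebra (K \<union> S)"
    by (simp add: field_adjoin_def)
  then show "x \<in> field_adjoin K' S'"
  proof induction
    case one
    then show ?case by (simp add: ring_of_type_algebra_def field_adjoin_1)
  next
    case (incl h)
    then show ?case using assms by blast
  next
    case (a_inv h)
    then show ?case by (simp add: a_inv_ring_of_type_algebra field_adjoin_uminus)
  next
    case (m_inv h)
    then have "h \<noteq> 0" by (simp add: ring_of_type_algebra_def)
    then show ?case by (simp add: m_inv_ring_of_type_algebra field_adjoin_inverse m_inv)
  next
    case (eng_add h1 h2)
    then show ?case by (simp add: ring_of_type_algebra_def field_adjoin_add)
  next
    case (eng_mult h1 h2)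
    then show ?case by (simp add: ring_of_type_algebra_def field_adjoin_mult)
  qed
qed

section \<open>Factorisations over the powers of a primitive root of unity\<close>

lemma primitive_root_of_unity_nonzero: "primitive_root_of_unity n z \<Longrightarrow> z \<noteq> 0"
  by (auto simp: primitive_root_of_unity_def power_0_left split: if_splits)

lemma primitive_root_of_unity_inj_on:
  assumes "primitive_root_of_unity n z"
  shows "inj_on (\<lambda>k. z ^ k) {..<n}"
proof (rule linorder_inj_onI)
  fix i j :: nat
  assume ij: "i < j" "i \<in> {..<n}" "j \<in> {..<n}"
  have z: "z \<noteq> 0" using assms by (rule primitive_root_of_unity_nonzero)
  have "z ^ (j - i) \<noteq> 1"
    using assms ij by (auto simp: primitive_root_of_unity_def)
  then show "z ^ i \<noteq> z ^ j"
    using ij z by (auto simp: power_diff)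
qed auto

text \<open>As polynomials in \<open>x\<close>, both sides are monic of degree \<open>n\<close> and
  vanish at the \<open>n\<close> distinct powers of \<open>z\<close>.\<close>

lemma prod_minus_roots_of_unity:
  fixes z :: "'a :: field"
  assumes z: "primitive_root_of_unity n z"
  shows "(\<Prod>k<n. x - z ^ k) = x ^ n - 1"
proof -
  have n: "n > 0" using z by (simp add: primitive_root_of_unity_def)
  have deg: "degree (\<Prod>k<n. [:- (z ^ k), 1:]) = n"
    by (subst degree_prod_eq_sum_degree) auto
  have lc: "lead_coeff (\<Prod>k<n. [:- (z ^ k), 1:]) = 1"
    by (subst lead_coeff_prod) auto
  have deg': "degree (monom 1 n - 1 :: 'a poly) \<le> n"
    by (intro degree_diff_le) (auto simp: degree_monom_eq)
  have "(\<Prod>k<n. [:- (z ^ k), 1:]) = monom 1 n - 1"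
  proof (rule poly_eqI_degree_lead_coeff[where n = n and A = "(\<lambda>k. z ^ k) ` {..<n}"])
    show "coeff (\<Prod>k<n. [:- (z ^ k), 1:]) n = coeff (monom 1 n - 1) n"
      using lc deg n by (simp add: coeff_1)
    show "card ((\<lambda>k. z ^ k) ` {..<n}) \<ge> n"
      using card_image[OF primitive_root_of_unity_inj_on[OF z]] by simp
    fix y assume "y \<in> (\<lambda>k. z ^ k) ` {..<n}"
    then obtain k where k: "k < n" "y = z ^ k" by auto
    have "y ^ n = 1"
      using z k by (metis primitive_root_of_unity_def power_commutes power_mult mult.commute power_one)
    moreover have "(\<Prod>i<n. y - z ^ i) = 0"
      using k by auto
    ultimately show "poly (\<Prod>k<n. [:- (z ^ k), 1:]) y = poly (monom 1 n - 1) y"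
      by (simp add: poly_prod poly_monom)
  qed (use deg deg' in auto)
  then have "poly (\<Prod>k<n. [:- (z ^ k), 1:]) x = poly (monom 1 n - 1) x" by simp
  then show ?thesis by (simp add: poly_prod poly_monom)
qed

lemma root_of_unity_eq_power:
  assumes "primitive_root_of_unity n z" and "w ^ n = 1"
  obtains k where "w = z ^ k"
  using prod_minus_roots_of_unity[OF assms(1), of w] assms(2) by auto

text \<open>As the exponent is odd, the left-hand side is the product of all
  \<open>a + z ^ k * b\<close>. The factor for \<open>k = 0\<close> is \<open>a + b\<close>; those
  for \<open>k\<close> and \<open>2 * m + 1 - k\<close> multiply to the factor with
  \<open>omega z k\<close>. For \<open>a * b = 1\<close> this links \<open>h_poly\<close> with power
  sums.\<close>

lemma sum_powers_eq_prod_omega: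
  fixes z a b :: "'a :: field"
  assumes z: "primitive_root_of_unity (2 * m + 1) z"
  shows "a ^ (2 * m + 1) + b ^ (2 * m + 1) = (a + b) * (\<Prod>k = 1..m. a\<^sup>2 + b\<^sup>2 + omega z k * (a * b))"
proof (cases "b = 0")
  case True
  then show ?thesis by (simp add: power_mult)
next
  case False
  let ?r = "2 * m + 1"
  let ?f = "\<lambda>k. a + z ^ k * b"
  \<comment> \<open>The factorisation of \<open>x ^ r - 1\<close> is taken at
    \<open>x = - a / b\<close>, hence the separate case \<open>b = 0\<close>.\<close>
  have "a ^ ?r + b ^ ?r = - (b ^ ?r) * ((- a / b) ^ ?r - 1)"
    using False by (simp add: field_simps)
  also have "\<dots> = (- b) ^ ?r * (\<Prod>k<?r. - a / b - z ^ k)"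
    by (subst prod_minus_roots_of_unity[OF z]) simp
  also have "\<dots> = (\<Prod>k<?r. - b * (- a / b - z ^ k))"
    by (subst prod.distrib) simp
  also have "\<dots> = (\<Prod>k<?r. ?f k)"
    using False by (intro prod.cong) (auto simp: field_simps)
  also have "{..<?r} = insert 0 ({1..m} \<union> {m+1..2*m})" by auto
  also have "(\<Prod>k\<in>\<dots>. ?f k) = (a + b) * ((\<Prod>k=1..m. ?f k) * (\<Prod>k=m+1..2*m. ?f k))"
    by (subst prod.insert, simp, simp, subst prod.union_disjoint) auto
  also have "(\<Prod>k=m+1..2*m. ?f k) = (\<Prod>k=1..m. ?f (?r - k))"
    by (rule prod.reindex_bij_witness[where i = "\<lambda>k. ?r - k" and j = "\<lambda>k. ?r - k"]) auto
  also have "(\<Prod>k=1..m. ?f k) * \<dots> = (\<Prod>k=1..m. ?f k * ?f (?r - k))"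
    by (rule prod.distrib[symmetric])
  also have "\<dots> = (\<Prod>k = 1..m. a\<^sup>2 + b\<^sup>2 + omega z k * (a * b))"
  proof (rule prod.cong)
    fix k assume k: "k \<in> {1..m}"
    have "z ^ k * z ^ (?r - k) = z ^ ?r"
      using k by (subst power_add[symmetric]) simp
    also have "\<dots> = 1" using z by (simp add: primitive_root_of_unity_def)
    finally have 1: "z ^ k * z ^ (?r - k) = 1" .
    then have 2: "z ^ (?r - k) = inverse z ^ k"
      by (metis inverse_unique power_inverse)
    have "?f k * ?f (?r - k)
        = a\<^sup>2 + (z ^ k * z ^ (?r - k)) * b\<^sup>2 + (z ^ k + z ^ (?r - k)) * (a * b)"
      by (simp add: power2_eq_square algebra_simps)
    then show "?f k * ?f (?r - k) = a\<^sup>2 + b\<^sup>2 + omega z k * (a * b)"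
      unfolding 1 unfolding 2 omega_def by simp
  qed simp
  finally show ?thesis .
qed

section \<open>Dickson polynomials and Lucas sequences\<close>

text \<open>Dickson polynomials of the first kind. Defined over any commutative ring, they let one
  integer polynomial be compared with its images in both algebraic closures.\<close>

fun dickson :: "'a :: comm_ring_1 \<Rightarrow> nat \<Rightarrow> 'a poly" where
  "dickson a 0 = [:2:]"
| "dickson a (Suc 0) = [:0, 1:]"
| "dickson a (Suc (Suc n)) = [:0, 1:] * dickson a (Suc n) - smult a (dickson a n)"

text \<open>The power sums satisfy the same recursion, \<open>u\<close> and \<open>v\<close> being
  the roots of \<open>T^2 - (u + v) T + u v\<close>.\<close>

lemma poly_dickson: "poly (dickson (u * v) n) (u + v) = u ^ n + v ^ n"
  by (induction "u * v" n rule: dickson.induct) (auto simp: algebra_simps)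

lemma map_poly_of_int_dickson:
  "map_poly of_int (dickson a n) = (dickson (of_int a) n :: 'a :: comm_ring_1 poly)"
  by (induction a n rule: dickson.induct)
    (simp_all add: Polynomial.map_poly_pCons of_int_hom.map_poly_hom_smult
      of_int_poly_hom.hom_minus of_int_poly_hom.hom_mult)

text \<open>The Lucas sequence of the first kind: a division-free form of
  \<open>(u ^ n - v ^ n) / (u - v)\<close> in terms of \<open>p = u + v\<close> and
  \<open>q = u * v\<close>, so its values stay in any field containing these two.\<close>

fun lucas_u :: "'a :: comm_ring_1 \<Rightarrow> 'a \<Rightarrow> nat \<Rightarrow> 'a" where
  "lucas_u p q 0 = 0"
| "lucas_u p q (Suc 0) = 1"
| "lucas_u p q (Suc (Suc n)) = p * lucas_u p q (Suc n) - q * lucas_u p q n"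

lemma lucas_u_binet: "(u - v) * lucas_u (u + v) (u * v) n = u ^ n - v ^ n"
proof (induction "u + v" "u * v" n rule: lucas_u.induct)
  case (3 n)
  have "(u - v) * lucas_u (u + v) (u * v) (Suc (Suc n))
      = (u + v) * ((u - v) * lucas_u (u + v) (u * v) (Suc n)) - u * v * ((u - v) * lucas_u (u + v) (u * v) n)"
    by (simp add: algebra_simps)
  then show ?case unfolding 3 by (simp add: algebra_simps)
qed auto

lemma lucas_u_in_field_adjoin:
  assumes "p \<in> field_adjoin K S" and "q \<in> field_adjoin K S"
  shows "lucas_u p q n \<in> field_adjoin K S"
  using assms by (induction p q n rule: lucas_u.induct) (auto intro: field_adjoin_closed)

section \<open>Roots of a Dickson polynomial minus a constant\<close>

text \<open>\<open>u\<close> is a root of \<open>T^2 - x T + c\<close>. This brings any argument of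
  a Dickson polynomial into the form that \<open>poly_dickson\<close> evaluates.\<close>

lemma sum_product_decomposition:
  fixes x c :: "'a :: alg_closed_field"
  obtains u v where "x = u + v" and "c = u * v"
proof -
  obtain u where "poly [:c, - x, 1:] u = 0"
    using alg_closed_imp_poly_has_root[of "[:c, - x, 1:]"] by auto
  then have "c = u * (x - u)" by (simp add: algebra_simps)
  then show ?thesis using that[of u "x - u"] by simp
qed

text \<open>For a root \<open>x = a + b\<close> with \<open>a * b = u * v\<close>, the pairs
  \<open>a ^ r, b ^ r\<close> and \<open>u ^ r, v ^ r\<close> have equal sum and product, so they
  agree up to order. Then \<open>a\<close> or \<open>b\<close> is \<open>z ^ k * u\<close>, and the
  product fixes the other one.\<close>

lemma roots_dickson_minus_const:
  fixes z u v :: "'a :: alg_closed_field"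
  assumes z: "primitive_root_of_unity r z" and "u \<noteq> 0" and "v \<noteq> 0"
  shows "{x. poly (dickson (u * v) r) x = u ^ r + v ^ r}
    = range (\<lambda>k. z ^ k * u + inverse z ^ k * v)"
proof (intro equalityI subsetI)
  fix x assume "x \<in> range (\<lambda>k. z ^ k * u + inverse z ^ k * v)"
  then obtain k where k: "x = z ^ k * u + inverse z ^ k * v" by auto
  have z0: "z \<noteq> 0" using z by (rule primitive_root_of_unity_nonzero)
  have zr: "(z ^ k) ^ r = 1" "(inverse z ^ k) ^ r = 1"
    using z by (simp_all add: primitive_root_of_unity_def power_inverse flip: power_mult)
      (simp_all add: mult.commute[of k] power_mult)
  \<comment> \<open>The parameter is rewritten as the product of the two summands of
    \<open>x\<close>, so that \<open>poly_dickson\<close> applies to them.\<close>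
  have uv: "u * v = (z ^ k * u) * (inverse z ^ k * v)"
    using z0 by (simp add: power_inverse field_simps)
  have "poly (dickson (u * v) r) x = u ^ r + v ^ r"
    unfolding k uv poly_dickson by (simp add: power_mult_distrib zr)
  then show "x \<in> {x. poly (dickson (u * v) r) x = u ^ r + v ^ r}" by simp
next
  fix x assume "x \<in> {x. poly (dickson (u * v) r) x = u ^ r + v ^ r}"
  then have x: "poly (dickson (u * v) r) x = u ^ r + v ^ r" by simp
  obtain a b where ab: "x = a + b" "u * v = a * b" by (rule sum_product_decomposition)
  have sum: "a ^ r + b ^ r = u ^ r + v ^ r"
    using x unfolding ab poly_dickson by simp
  have prod: "a ^ r * b ^ r = u ^ r * v ^ r"
    by (metis ab(2) power_mult_distrib)
  have factor: "(A - U) * (A - V) = 0" if "A + B = U + V" "A * B = U * V" for A B U V :: 'a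
  proof -
    have "(A - U) * (A - V) = A * A - A * (U + V) + U * V" by (simp add: algebra_simps)
    then show ?thesis by (simp add: algebra_simps flip: that)
  qed
  have "(a ^ r - u ^ r) * (a ^ r - v ^ r) = 0"
    using factor[OF sum prod] .
  then consider "a ^ r = u ^ r" | "b ^ r = u ^ r"
    using sum by fastforce
  \<comment> \<open>Stated for \<open>c\<close> and \<open>e\<close> so that it serves both cases,
    with \<open>a\<close> and \<open>b\<close> in either order.\<close>
  moreover have "x \<in> range (\<lambda>k. z ^ k * u + inverse z ^ k * v)"
    if "c ^ r = u ^ r" "x = c + e" "u * v = c * e" for c e
  proof -
    have "(c / u) ^ r = 1"
      using that assms(2) by (simp add: power_divide)
    then obtain k where k: "c / u = z ^ k"
      by (rule root_of_unity_eq_power[OF z])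
    have z0: "z \<noteq> 0" using z by (rule primitive_root_of_unity_nonzero)
    have c: "c = z ^ k * u" using k assms(2) by (simp add: field_simps)
    then have "e = inverse z ^ k * v"
      using that(3) z0 assms(2) by (simp add: power_inverse field_simps)
    then show ?thesis using c that(2) by auto
  qed
  ultimately show "x \<in> range (\<lambda>k. z ^ k * u + inverse z ^ k * v)"
    using ab by (metis add.commute mult.commute)
qed

section \<open>Comparison of the two generated fields\<close>

text \<open>The scalar \<open>\<kappa>\<close> absorbs the factor from \<open>K\<close> that
  separates \<open>tau z * (u ^ r - v ^ r)\<close> from the wanted generator \<open>y\<close>; it is
  invertible and so does not affect the field.\<close>

lemma field_adjoin_dickson_roots:
  fixes K :: "'a :: field set" and z u v \<kappa> y :: 'a
  assumes two: "(2 :: 'a) \<noteq> 0" and z: "z \<noteq> 0" "z\<^sup>2 \<noteq> 1" and uv: "u \<noteq> 0" "v \<noteq> 0" "u * v \<in> K"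
    and ne: "u ^ r \<noteq> v ^ r"
    and \<kappa>: "\<kappa> \<in> K" "\<kappa> \<noteq> 0" and y: "\<kappa> * y = tau z * (u ^ r - v ^ r)"
  shows "field_adjoin K (range (\<lambda>k. z ^ k * u + inverse z ^ k * v))
    = field_adjoin (field_adjoin K {omega z 1}) {u + v, y}"
proof -
  define \<Gamma> where "\<Gamma> k = z ^ k * u + inverse z ^ k * v" for k
  define L where "L = field_adjoin K (range \<Gamma>)"
  define M where "M = field_adjoin (field_adjoin K {omega z 1}) {u + v, y}"
  note closedL = field_adjoin_closed[where K = K and S = "range \<Gamma>", folded L_def]
  note closedM = field_adjoin_closed
    [where K = "field_adjoin K {omega z 1}" and S = "{u + v, y}", folded M_def]
  have rec: "\<Gamma> (Suc (Suc k)) = omega z 1 * \<Gamma> (Suc k) - \<Gamma> k" for k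
    using z(1) by (simp add: \<Gamma>_def omega_def power_inverse field_simps)
  have \<Gamma>0: "\<Gamma> 0 = u + v" by (simp add: \<Gamma>_def)
  \<comment> \<open>The right-hand side is \<open>\<Gamma> 1 - \<Gamma> (-1)\<close>, with the root
    of index -1 eliminated by the recursion because indices are natural numbers.\<close>
  have tau: "tau z * (u - v) = 2 * \<Gamma> 1 - omega z 1 * \<Gamma> 0"
    by (simp add: \<Gamma>_def tau_def omega_def algebra_simps)
  define U where "U = lucas_u (u + v) (u * v) r"
  have U: "(u - v) * U = u ^ r - v ^ r"
    unfolding U_def by (rule lucas_u_binet)
  have U0: "U \<noteq> 0" using U ne by auto
  have y': "\<kappa> * y = (tau z * (u - v)) * U"
    unfolding y U[symmetric] by (simp add: algebra_simps)

  have \<Gamma>L: "\<Gamma> k \<in> L" for k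
    unfolding L_def by (rule field_adjoin_incl) auto
  have KL: "k \<in> L" if "k \<in> K" for k
    unfolding L_def using that by (intro field_adjoin_incl) auto
  have KM: "k \<in> M" if "k \<in> K" for k
    unfolding M_def using that by (intro field_adjoin_incl) (auto intro: field_adjoin_incl)
  have \<omega>M: "omega z 1 \<in> M"
    unfolding M_def by (intro field_adjoin_incl) (auto intro: field_adjoin_incl)
  have genM: "u + v \<in> M" "y \<in> M"
    unfolding M_def by (intro field_adjoin_incl; simp)+

  have \<omega>L: "omega z 1 \<in> L"
  proof -
    \<comment> \<open>Indices 1 and 2 are used rather than 0 and 1, so that the nonzero root has a
      predecessor in the recursion solved for \<open>omega z 1\<close>.\<close>
    have "\<Gamma> 1 \<noteq> 0 \<or> \<Gamma> 2 \<noteq> 0"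
    proof (rule ccontr)
      assume "\<not> ?thesis"
      then have "\<Gamma> 1 = 0" "\<Gamma> 2 = 0" by auto
      then have "z\<^sup>2 * u = - v" "z ^ 4 * u = - v"
        using z(1) by (auto simp: \<Gamma>_def power_inverse field_simps add_eq_0_iff2
            power2_eq_square power4_eq_xxxx)
      moreover have "z\<^sup>2 * (z\<^sup>2 - 1) * u = z ^ 4 * u - z\<^sup>2 * u"
        by (simp add: algebra_simps power2_eq_square power4_eq_xxxx)
      ultimately have "z\<^sup>2 * (z\<^sup>2 - 1) * u = 0" by simp
      then show False using z uv by auto
    qed
    then obtain k where k: "\<Gamma> (Suc k) \<noteq> 0"
      by (metis One_nat_def Suc_1)
    then have "omega z 1 = (\<Gamma> (Suc (Suc k)) + \<Gamma> k) / \<Gamma> (Suc k)"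
      by (simp add: rec)
    then show ?thesis by (metis closedL \<Gamma>L)
  qed

  have "U \<in> L"
    unfolding U_def L_def
    by (intro lucas_u_in_field_adjoin; fold L_def) (use \<Gamma>L[of 0] \<Gamma>0 KL uv in auto)
  moreover have "tau z * (u - v) \<in> L"
    unfolding tau by (intro closedL \<Gamma>L \<omega>L)
  moreover have "y = (tau z * (u - v)) * U / \<kappa>"
    using y' \<kappa> by (simp add: field_simps)
  ultimately have yL: "y \<in> L"
    using KL[OF \<kappa>(1)] by (simp add: closedL)

  have UM: "U \<in> M"
    unfolding U_def M_def
    by (intro lucas_u_in_field_adjoin; fold M_def) (use genM KM uv in auto)
  have "tau z * (u - v) = \<kappa> * y / U"
    using y' U0 by (simp add: field_simps)
  then have "tau z * (u - v) \<in> M"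
    using closedM KM[OF \<kappa>(1)] UM genM by metis
  moreover have "\<Gamma> 1 = (tau z * (u - v) + omega z 1 * \<Gamma> 0) / 2"
    unfolding tau using two by simp
  ultimately have \<Gamma>1M: "\<Gamma> 1 \<in> M"
    using closedM \<omega>M genM \<Gamma>0 by metis
  \<comment> \<open>Two consecutive roots are carried along since the recursion has order
    two.\<close>
  have \<Gamma>M: "\<Gamma> k \<in> M \<and> \<Gamma> (Suc k) \<in> M" for k
    by (induction k) (use \<Gamma>1M \<Gamma>0 genM in \<open>auto simp: rec intro!: closedM \<omega>M[unfolded One_nat_def]\<close>)

  have "L \<subseteq> M"
    unfolding L_def M_def by (rule field_adjoin_least; fold M_def) (use KM \<Gamma>M in auto)
  moreover have "M \<subseteq> L"
    unfolding L_def M_def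
  proof (rule field_adjoin_least; fold L_def)
    have "field_adjoin K {omega z 1} \<subseteq> L"
      unfolding L_def by (rule field_adjoin_least; fold L_def) (use KL \<omega>L in auto)
    then show "field_adjoin K {omega z 1} \<union> {u + v, y} \<subseteq> L"
      using yL \<Gamma>L[of 0] \<Gamma>0 by auto
  qed
  ultimately show ?thesis
    unfolding L_def M_def \<Gamma>_def by blast
qed

section \<open>The given polynomial as a shifted Dickson polynomial\<close>

text \<open>Values are compared at \<open>x = u + v\<close> with \<open>u * v = d\<^sup>2\<close>.
  After scaling by \<open>d\<close> the summands satisfy \<open>a * b = 1\<close>, so
  \<open>2 - (a + b)\<^sup>2 = - (a\<^sup>2 + b\<^sup>2)\<close>; the sign in
  \<open>g_minus_s\<close> cancels the \<open>m\<close> minus signs and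
  \<open>sum_powers_eq_prod_omega\<close> applies.\<close>

lemma g_minus_eq_dickson:
  fixes z s d :: "'a :: {alg_closed_field, field_char_0}"
  assumes z: "primitive_root_of_unity r z" and r: "odd r" and d: "d \<noteq> 0"
  shows "g_minus r z s d = dickson (d\<^sup>2) r + [:d ^ r * (2 - 4 * s):]"
proof (rule poly_ext)
  fix x
  obtain m where m: "r = 2 * m + 1" using r by (elim oddE)
  obtain u v where uv: "x = u + v" "d\<^sup>2 = u * v" by (rule sum_product_decomposition)
  define a b where "a = u / d" and "b = v / d"
  have ab: "a * b = 1" "x / d = a + b"
    using d by (simp_all add: a_def b_def uv(1) add_divide_distrib flip: power2_eq_square uv(2))
  have "(-1) ^ m * (\<Prod>j = 1..m. 2 - (a + b)\<^sup>2 - omega z j)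
      = (\<Prod>j = 1..m. - (2 - (a + b)\<^sup>2 - omega z j))"
    using prod.distrib[of "\<lambda>_. -1" "\<lambda>j. 2 - (a + b)\<^sup>2 - omega z j" "{1..m}"] by simp
  also have "\<dots> = (\<Prod>j = 1..m. a\<^sup>2 + b\<^sup>2 + omega z j * (a * b))"
    using ab by (intro prod.cong) (auto simp: power2_eq_square algebra_simps)
  finally have prod: "(-1) ^ m * (\<Prod>j = 1..m. 2 - (a + b)\<^sup>2 - omega z j)
      = (\<Prod>j = 1..m. a\<^sup>2 + b\<^sup>2 + omega z j * (a * b))" .
  have "poly (g_minus_s r z s) (a + b)
      = (a + b) * ((-1) ^ m * (\<Prod>j = 1..m. 2 - (a + b)\<^sup>2 - omega z j)) + (2 - 4 * s)"
    by (simp add: g_minus_s_def h_poly_def poly_pcompose poly_prod m power2_eq_square algebra_simps)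
  also have "\<dots> = a ^ r + b ^ r + (2 - 4 * s)"
    unfolding prod using sum_powers_eq_prod_omega[OF z[unfolded m], of a b] m by simp
  finally have g: "poly (g_minus_s r z s) (a + b) = a ^ r + b ^ r + (2 - 4 * s)" .
  have "poly (g_minus r z s d) x = d ^ r * poly (g_minus_s r z s) (x / d)"
    by (simp add: g_minus_def poly_pcompose)
  also have "\<dots> = u ^ r + v ^ r + d ^ r * (2 - 4 * s)"
    unfolding ab g using d by (simp add: a_def b_def power_divide field_simps)
  also have "\<dots> = poly (dickson (d\<^sup>2) r + [:d ^ r * (2 - 4 * s):]) x"
    unfolding uv by (simp add: poly_dickson)
  finally show "poly (g_minus r z s d) x = poly (dickson (d\<^sup>2) r + [:d ^ r * (2 - 4 * s):]) x" .
qed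

section \<open>The splitting field over the q-adic numbers\<close>

theorem theorem4p36:
  fixes r :: nat
    and \<zeta> s\<^sub>0 \<delta> :: "rat alg_closure"
    and \<iota> :: "rat alg_closure \<Rightarrow> 'q :: prime_card padic alg_closure"
    and sqrt_s\<^sub>0 sqrt_s\<^sub>0_minus_1 \<alpha>\<^sub>0 \<gamma>\<^sub>0 :: "'q padic alg_closure"
  assumes "prime r" and "r \<ge> 5"
    and "primitive_root_of_unity r \<zeta>"
    and "s\<^sub>0 \<noteq> 0" and "s\<^sub>0 \<noteq> 1"
    and "algebraic_int \<delta>" and "\<delta> \<noteq> 0"
    and "\<delta> ^ 2 \<in> \<int>" and "\<delta> ^ r * (2 - 4 * s\<^sub>0) \<in> \<int>"
    and "field_hom \<iota>"
    and "sqrt_s\<^sub>0 ^ 2 = \<iota> s\<^sub>0"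
    and "sqrt_s\<^sub>0_minus_1 ^ 2 = \<iota> s\<^sub>0 - 1"
    and "\<alpha>\<^sub>0 ^ r = 2 * \<iota> s\<^sub>0 - 1 + 2 * (sqrt_s\<^sub>0 * sqrt_s\<^sub>0_minus_1)"
    and "\<gamma>\<^sub>0 = \<iota> \<delta> * (\<alpha>\<^sub>0 + inverse \<alpha>\<^sub>0)"
  shows "\<exists>G :: int poly.
           map_poly of_int G = g_minus r \<zeta> s\<^sub>0 \<delta> \<and>
           splitting_field (map_poly of_int G :: 'q padic poly) =
             field_adjoin (field_adjoin (range to_ac) {\<iota> (omega \<zeta> 1)})
               {\<gamma>\<^sub>0, \<iota> \<delta> * \<iota> (tau \<zeta>) * (sqrt_s\<^sub>0 * sqrt_s\<^sub>0_minus_1)}"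
proof -
  interpret \<iota>: field_hom \<iota> by fact
  define z d ss where "z = \<iota> \<zeta>" and "d = \<iota> \<delta>" and "ss = sqrt_s\<^sub>0 * sqrt_s\<^sub>0_minus_1"
  define u v where "u = d * \<alpha>\<^sub>0" and "v = d * inverse \<alpha>\<^sub>0"
  have "odd r" using assms(1,2) by (auto simp: prime_odd_nat)
  then obtain m where m: "r = 2 * m + 1" by (elim oddE)
  obtain a where a: "\<delta>\<^sup>2 = of_int a" using assms(8) by (elim Ints_cases)
  obtain c where c: "\<delta> ^ r * (2 - 4 * s\<^sub>0) = of_int c" using assms(9) by (elim Ints_cases)
  define G where "G = dickson a r + [:c:]"
  \<comment> \<open>Kept polymorphic: it is applied over the closure of the rationals and over that
    of the q-adic numbers.\<close>
  have mapG: "map_poly of_int G = (dickson (of_int a) r + [:of_int c:] :: 'a :: comm_ring_1 poly)"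
    by (simp add: G_def Polynomial.map_poly_pCons of_int_poly_hom.hom_add map_poly_of_int_dickson)
  have "map_poly of_int G = g_minus r \<zeta> s\<^sub>0 \<delta>"
    using g_minus_eq_dickson[OF assms(3) \<open>odd r\<close> assms(7), of s\<^sub>0] by (simp add: mapG a c)
  moreover have "splitting_field (map_poly of_int G :: 'q padic poly) =
      field_adjoin (field_adjoin (range to_ac) {omega z 1}) {u + v, d * tau z * ss}"
  proof -
    have \<iota>_num: "\<iota> (numeral n) = numeral n" for n
      using \<iota>.hom_of_nat[of "numeral n"] by simp
    have z: "primitive_root_of_unity r z"
      using assms(3) by (simp add: primitive_root_of_unity_def z_def flip: \<iota>.hom_power)
    \<comment> \<open>Characteristic zero is transported along the injective map
      \<open>\<iota>\<close>.\<close>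
    have two: "(2 :: 'q padic alg_closure) \<noteq> 0"
      using \<iota>_num[of "num.Bit0 num.One"] \<iota>.hom_0_iff[of 2] by simp
    have four: "(4 :: 'q padic alg_closure) \<noteq> 0"
      using two by (metis mult_eq_0_iff numeral_Bit0 mult_2)
    have d0: "d \<noteq> 0" using assms(7) by (simp add: d_def)
    have "ss\<^sup>2 = \<iota> s\<^sub>0 * (\<iota> s\<^sub>0 - 1)"
      using assms(11,12) by (simp add: ss_def power_mult_distrib)
    \<comment> \<open>The conjugate expression is the inverse of
      \<open>\<alpha>\<^sub>0 ^ r\<close>, since \<open>(2 s - 1)^2 - 4 s (s - 1) = 1\<close>. This
      makes both \<open>u ^ r\<close> and \<open>v ^ r\<close> explicit.\<close>
    moreover have "(2 * \<iota> s\<^sub>0 - 1 + 2 * ss) * (2 * \<iota> s\<^sub>0 - 1 - 2 * ss)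
        = 4 * (\<iota> s\<^sub>0 * (\<iota> s\<^sub>0 - 1)) + 1 - 4 * ss\<^sup>2"
      by (simp add: algebra_simps power2_eq_square)
    ultimately have inv: "(2 * \<iota> s\<^sub>0 - 1 + 2 * ss) * (2 * \<iota> s\<^sub>0 - 1 - 2 * ss) = 1"
      by simp
    have ss0: "ss \<noteq> 0"
      using assms(4,5,11,12) \<iota>.hom_0_iff[of s\<^sub>0] \<iota>.hom_0_iff[of "s\<^sub>0 - 1"]
      by (auto simp: ss_def \<iota>.hom_minus)
    have \<alpha>r: "\<alpha>\<^sub>0 ^ r = 2 * \<iota> s\<^sub>0 - 1 + 2 * ss"
      using assms(13) by (simp add: ss_def)
    have \<alpha>0: "\<alpha>\<^sub>0 \<noteq> 0" using \<alpha>r inv m by auto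
    have \<alpha>r': "inverse \<alpha>\<^sub>0 ^ r = 2 * \<iota> s\<^sub>0 - 1 - 2 * ss"
      using inv unfolding \<alpha>r[symmetric] power_inverse by (rule inverse_unique)
    have uv_d: "u * v = d\<^sup>2"
      using \<alpha>0 by (simp add: u_def v_def power2_eq_square field_simps)
    also have "d\<^sup>2 = of_int a"
      using arg_cong[OF a, of \<iota>] by (simp add: d_def \<iota>.hom_power \<iota>.hom_of_int)
    finally have uv: "u * v = of_int a" .
    have uv0: "u \<noteq> 0" "v \<noteq> 0" using d0 \<alpha>0 by (auto simp: u_def v_def)
    \<comment> \<open>This is minus the constant \<open>c\<close> added in \<open>G\<close>, so the
      roots of \<open>G\<close> are the points where the Dickson polynomial takes the value
      \<open>u ^ r + v ^ r\<close>.\<close>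
    have sum: "u ^ r + v ^ r = - of_int c"
    proof -
      have "u ^ r + v ^ r = - (d ^ r * (2 - 4 * \<iota> s\<^sub>0))"
        unfolding u_def v_def power_mult_distrib \<alpha>r \<alpha>r' by (simp add: algebra_simps)
      also have "d ^ r * (2 - 4 * \<iota> s\<^sub>0) = \<iota> (\<delta> ^ r * (2 - 4 * s\<^sub>0))"
        by (simp add: d_def \<iota>.hom_mult \<iota>.hom_power \<iota>.hom_minus \<iota>_num)
      finally show ?thesis by (simp add: c \<iota>.hom_of_int)
    qed
    \<comment> \<open>As \<open>r = 2 * m + 1\<close>, all but one factor of \<open>d ^ r\<close>
      combine to the integer power \<open>a ^ m\<close>. So \<open>4 * of_int a ^ m\<close> can
      serve as \<open>\<kappa>\<close>, leaving \<open>d * ss\<close>.\<close>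
    have diff: "u ^ r - v ^ r = 4 * of_int a ^ m * (d * ss)"
    proof -
      have "u ^ r - v ^ r = d ^ r * (4 * ss)"
        unfolding u_def v_def power_mult_distrib \<alpha>r \<alpha>r' by (simp add: algebra_simps)
      also have "d ^ r = (u * v) ^ m * d"
        by (simp add: m uv_d power_mult)
      finally show ?thesis by (simp add: uv algebra_simps)
    qed
    have a0: "(of_int a :: 'q padic alg_closure) \<noteq> 0"
      using uv uv0 by auto
    have roots: "{x. poly (map_poly to_ac (map_poly of_int G :: 'q padic poly)) x = 0}
        = range (\<lambda>k. z ^ k * u + inverse z ^ k * v)"
    proof -
      have "map_poly to_ac (map_poly of_int G :: 'q padic poly) = map_poly of_int G"
        by (subst map_poly_map_poly) (simp_all add: o_def)
      then have "{x. poly (map_poly to_ac (map_poly of_int G :: 'q padic poly)) x = 0}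
          = {x. poly (dickson (u * v) r) x = u ^ r + v ^ r}"
        by (simp add: mapG uv sum add_eq_0_iff2)
      then show ?thesis by (simp only: roots_dickson_minus_const[OF z uv0])
    qed
    have K: "of_int n \<in> range (to_ac :: 'q padic \<Rightarrow> _)" for n
      by (metis rangeI to_ac_of_int)
    show ?thesis
      unfolding splitting_field_def roots
    proof (rule field_adjoin_dickson_roots)
      show "z \<noteq> 0" using z by (rule primitive_root_of_unity_nonzero)
      show "z\<^sup>2 \<noteq> 1" using z assms(2) by (simp add: primitive_root_of_unity_def)
      show "u * v \<in> range to_ac" unfolding uv by (rule K)
      show "u ^ r \<noteq> v ^ r"
        using diff four a0 d0 ss0 by auto
      show "4 * of_int a ^ m \<in> range (to_ac :: 'q padic \<Rightarrow> _)"
        using K[of "4 * a ^ m"] by simp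
      show "4 * of_int a ^ m \<noteq> (0 :: 'q padic alg_closure)"
        using four a0 by simp
      show "4 * of_int a ^ m * (d * tau z * ss) = tau z * (u ^ r - v ^ r)"
        unfolding diff by (simp add: algebra_simps)
    qed (use two uv0 in auto)
  qed
  moreover have "omega z 1 = \<iota> (omega \<zeta> 1)" "tau z = \<iota> (tau \<zeta>)" "u + v = \<gamma>\<^sub>0"
    using assms(14)
    by (simp_all add: z_def omega_def tau_def u_def v_def d_def \<iota>.hom_add \<iota>.hom_minus
        \<iota>.hom_inverse algebra_simps)
  ultimately show ?thesis
    unfolding d_def ss_def by metis
qed

end
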